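(* Let $L$ be a finite lattice with minimum $\hat{0}$ and maximum $\hat{1}$, generalized graded by $\rho$. If $x \in L$ is a left-modular element, then $$\chi(L,t) = \sum_{b \in H(L):\ b \wedge x = \hat{0}} \mu(b)\, t^{\rho(\hat{1}) - \rho(b \vee x)}\, \chi([b, b \vee x], t).$$
   Context: A generalized rank function on $L$ is a function $\rho : \{(u,v) \in L \times L : u \le v\} \to \mathbb{R}$ such that $\rho(a,c) = \rho(a,b) + \rho(b,c)$ for all $a \le b \le c$; then $L$ is said to be generalized graded by $\rho$, and one writes $\rho(u) = \rho(\hat{0}, u)$. The (generalized) characteristic polynomial is $\chi(L,t) = \sum_{u \in L} \mu(u)\, t^{\rho(u,\hat{1})}$, where $\mu$ is the Möbius function of $L$ and $\mu(u) = \mu(\hat{0},u)$; for an interval $[a,b]$, $\chi([a,b],t) = \sum_{u \in [a,b]} \mu(a,u)\, t^{\rho(u,b)}$ using the restriction of $\rho$. The support of $\mu$ is $H(L) = \{u \in L : \mu(\hat{0},u) \neq 0\}$. An element $x$ is left-modular if for all $y, z \in L$ with $z < y$ one has $z \vee (x \wedge y) = (z \vee x) \wedge y$. *)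

theory Defs
  imports Complex_Main "HOL-Library.Poly_Mapping"
begin

function mobius :: "'a::{finite, order} \<Rightarrow> 'a \<Rightarrow> int" where
  "mobius a b = (if a = b then 1 else if a < b then - (\<Sum>c\<in>{a..<b}. mobius a c) else 0)"
  by pat_completeness auto
termination
proof (relation "measure (\<lambda>(a, b). card {..<b})")
  fix a b c :: 'a
  assume "c \<in> {a..<b}"
  then have "{..<c} \<subset> {..<b}"
    by (auto dest: less_trans)
  then show "((a, c), (a, b)) \<in> measure (\<lambda>(a, b). card {..<b})"
    by (simp add: psubset_card_mono)
qed simp

text \<open>The recursion equation would make the simplifier loop.\<close>
declare mobius.simps [simp del]

definition mobius_support :: "'a::{finite, order_bot} set" where
  "mobius_support = {u. mobius bot u \<noteq> 0}"

text \<open>A rank function is a total function of two arguments; its values at pairs that are not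
  of the form \<open>u \<le> v\<close> are unconstrained and never used.\<close>
definition generalized_rank :: "('a::order \<Rightarrow> 'a \<Rightarrow> real) \<Rightarrow> bool" where
  "generalized_rank \<rho> \<longleftrightarrow> (\<forall>a b c. a \<le> b \<and> b \<le> c \<longrightarrow> \<rho> a c = \<rho> a b + \<rho> b c)"

definition rank_of :: "('a::order_bot \<Rightarrow> 'a \<Rightarrow> real) \<Rightarrow> 'a \<Rightarrow> real" where
  "rank_of \<rho> u = \<rho> bot u"

text \<open>Since ranks are arbitrary reals, a characteristic polynomial is a finite formal sum
  \<open>\<Sum>r. c r * t ^ r\<close> with real exponents \<open>r\<close> and integer coefficients, an element of the group
  ring of the additive group of the reals over the integers. In \<^typ>\<open>real \<Rightarrow>\<^sub>0 int\<close> (finitely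
  supported functions with convolution as product) the monomial \<open>t ^ r\<close> is the following.\<close>
definition tpow :: "real \<Rightarrow> (real \<Rightarrow>\<^sub>0 int)" where
  "tpow r = Poly_Mapping.single r 1"

definition char_poly :: "('a::{finite, bounded_lattice} \<Rightarrow> 'a \<Rightarrow> real) \<Rightarrow> (real \<Rightarrow>\<^sub>0 int)" where
  "char_poly \<rho> = (\<Sum>u\<in>UNIV. of_int (mobius bot u) * tpow (\<rho> u top))"

text \<open>The Moebius function of an interval is the restriction of that of the whole lattice.\<close>
definition char_poly_interval ::
    "('a::{finite, order} \<Rightarrow> 'a \<Rightarrow> real) \<Rightarrow> 'a \<Rightarrow> 'a \<Rightarrow> (real \<Rightarrow>\<^sub>0 int)" where
  "char_poly_interval \<rho> a b = (\<Sum>u\<in>{a..b}. of_int (mobius a u) * tpow (\<rho> u b))"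

definition left_modular :: "'a::lattice \<Rightarrow> bool" where
  "left_modular x \<longleftrightarrow> (\<forall>y z. z < y \<longrightarrow> sup z (inf x y) = inf (sup z x) y)"

end

theory Submission
  imports Defs
begin

text \<open>Comparing coefficients, it suffices that
  \<open>\<mu>(u) = (\<Sum>b. \<mu>(b) \<mu>(b,u))\<close>, the sum over all \<open>b\<close> with \<open>b \<and> x = 0\<close> and \<open>b \<le> u \<le> b \<or> x\<close>.
  As \<open>\<mu>\<close> is characterised by its sums over principal ideals, sum the right-hand side over
  \<open>u \<le> v\<close>: the inner sum of \<open>\<mu>(b,u)\<close> runs over the interval from \<open>b\<close> to
  \<open>(b \<or> x) \<and> v = b \<or> (x \<and> v)\<close> (left modularity), so it vanishes unless \<open>x \<and> v \<le> b\<close>,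
  which together with \<open>b \<and> x = 0\<close> means \<open>x \<and> v = 0\<close>. What remains is
  \<open>(\<Sum>b \<le> v. \<mu>(b))\<close>, which is \<open>1\<close> for \<open>v = 0\<close> and \<open>0\<close> otherwise.\<close>

lemma sum_mobius_interval:
  fixes a b :: "'a::{finite, order}"
  assumes "a \<le> b"
  shows "(\<Sum>c\<in>{a..b}. mobius a c) = (if a = b then 1 else 0)"
proof (cases "a = b")
  case True
  then show ?thesis by (simp add: mobius.simps)
next
  case False
  with assms have "a < b" by simp
  moreover from assms have "{a..b} = insert b {a..<b}" by auto
  ultimately show ?thesis by (simp add: mobius.simps[of a b])
qed

lemma sum_mobius_atMost:
  fixes v :: "'a::{finite, order_bot}"
  shows "(\<Sum>u\<in>{..v}. mobius bot u) = (if v = bot then 1 else 0)"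
proof -
  have "{..v} = {bot..v}" by auto
  then show ?thesis using sum_mobius_interval[of bot v] by auto
qed

text \<open>Strong induction on \<open>v\<close>: the terms strictly below \<open>v\<close> agree
  and cancel, leaving those at \<open>v\<close>. This is the uniqueness half of Moebius
  inversion.\<close>

lemma sum_atMost_inject:
  fixes f g :: "'a::{finite, order} \<Rightarrow> 'b::ab_group_add"
  assumes "\<And>v. sum f {..v} = sum g {..v}"
  shows "f v = g v"
proof (induction v rule: measure_induct_rule[where f = "\<lambda>v. card {..<v}"])
  case (less v)
  have "f u = g u" if "u < v" for u
    using that by (intro less psubset_card_mono) (auto dest: less_trans)
  then have "sum f {..<v} = sum g {..<v}" by (intro sum.cong) auto
  moreover have "{..v} = insert v {..<v}" by auto
  ultimately show ?case using assms[of v] by simp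
qed

text \<open>The definition covers only \<open>z < y\<close>; for \<open>z = y\<close> both sides
  equal \<open>y\<close> by absorption. The case arises below when \<open>b = v\<close>.\<close>

lemma left_modular_sup_inf:
  assumes "left_modular x" "z \<le> y"
  shows "inf (sup z x) y = sup z (inf x y)"
proof (cases "z = y")
  case True
  then show ?thesis by (simp add: inf_absorb2 sup_absorb1)
next
  case False
  with assms show ?thesis by (simp add: left_modular_def)
qed

lemma mobius_left_modular:
  fixes x u :: "'a::{finite, bounded_lattice}"
  assumes "left_modular x"
  shows "mobius bot u = (\<Sum>b | inf b x = bot \<and> b \<le> u \<and> u \<le> sup b x. mobius bot b * mobius b u)"
proof -
  define F where
    "F u = (\<Sum>b | inf b x = bot \<and> b \<le> u \<and> u \<le> sup b x. mobius bot b * mobius b u)" for u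
  have "sum F {..v} = sum (mobius bot) {..v}" for v
  proof -
    have inner: "(\<Sum>u | u \<in> {..v} \<and> inf b x = bot \<and> b \<le> u \<and> u \<le> sup b x. mobius bot b * mobius b u)
        = (if b \<le> v \<and> inf x v = bot then mobius bot b else 0)" for b
    proof (cases "inf b x = bot \<and> b \<le> v")
      case True
      have eq: "{u. u \<in> {..v} \<and> inf b x = bot \<and> b \<le> u \<and> u \<le> sup b x} = {b..sup b (inf x v)}"
        using True left_modular_sup_inf[OF assms, of b v, symmetric] by auto
      have "b = sup b (inf x v) \<longleftrightarrow> inf x v \<le> b" by (metis le_iff_sup sup_commute)
      \<comment> \<open>An element below both \<open>b\<close> and \<open>x\<close> lies below
        \<open>inf b x = bot\<close>.\<close>
      also have "\<dots> \<longleftrightarrow> inf x v = bot"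
        using True by (metis bot.extremum bot.extremum_uniqueI inf.bounded_iff inf_le1)
      finally have "b = sup b (inf x v) \<longleftrightarrow> inf x v = bot" .
      then show ?thesis
        unfolding eq sum_distrib_left[symmetric] using True
        by (simp add: sum_mobius_interval)
    next
      case False
      then have empty: "{u. u \<in> {..v} \<and> inf b x = bot \<and> b \<le> u \<and> u \<le> sup b x} = {}"
        by (auto dest: order_trans)
      \<comment> \<open>If both held, then \<open>inf b x \<le> inf v x = bot\<close>, against the
        case assumption.\<close>
      have "\<not> (b \<le> v \<and> inf x v = bot)"
        using False by (metis bot.extremum_uniqueI inf_commute inf_mono order_refl)
      then show ?thesis unfolding empty by auto
    qed
    have "sum F {..v} =
        (\<Sum>b\<in>UNIV. \<Sum>u | u \<in> {..v} \<and> inf b x = bot \<and> b \<le> u \<and> u \<le> sup b x. mobius bot b * mobius b u)"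
      unfolding F_def
      using sum.swap_restrict[of "{..v}" UNIV "\<lambda>u b. mobius bot b * mobius b u"
          "\<lambda>u b. inf b x = bot \<and> b \<le> u \<and> u \<le> sup b x"] by simp
    also have "\<dots> = (\<Sum>b\<in>UNIV. if b \<le> v \<and> inf x v = bot then mobius bot b else 0)"
      by (simp only: inner)
    also have "\<dots> = (if inf x v = bot then sum (mobius bot) {..v} else 0)"
      by (simp add: sum.If_cases atMost_def)
    \<comment> \<open>If \<open>inf x v\<close> is not \<open>bot\<close>, then \<open>v\<close> is
      not \<open>bot\<close>, so the full sum is 0 as well.\<close>
    also have "\<dots> = sum (mobius bot) {..v}"
      by (auto simp: sum_mobius_atMost)
    finally show ?thesis .
  qed
  then have "F u = mobius bot u" by (rule sum_atMost_inject)
  then show ?thesis by (simp add: F_def)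
qed

lemma tpow_add: "tpow (r + s) = tpow r * tpow s"
  by (simp add: tpow_def mult_single)

theorem theorem2p3:
  fixes \<rho> :: "'a::{finite, bounded_lattice} \<Rightarrow> 'a \<Rightarrow> real" and x :: 'a
  assumes "generalized_rank \<rho>"
    and "left_modular x"
  shows "char_poly \<rho> =
    (\<Sum>b\<in>{b \<in> mobius_support. inf b x = bot}.
       of_int (mobius bot b) * tpow (rank_of \<rho> top - rank_of \<rho> (sup b x))
         * char_poly_interval \<rho> b (sup b x))"
proof -
  define T where "T b u = of_int (mobius bot b * mobius b u) * tpow (\<rho> u top)" for b u
  have summand: "of_int (mobius bot b) * tpow (rank_of \<rho> top - rank_of \<rho> (sup b x))
      * char_poly_interval \<rho> b (sup b x) = (\<Sum>u\<in>{b..sup b x}. T b u)" for b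
  proof -
    have rank: "\<rho> a c = \<rho> a b + \<rho> b c" if "a \<le> b" "b \<le> c" for a b c
      using assms(1) that by (simp add: generalized_rank_def)
    \<comment> \<open>Additivity at \<open>sup b x\<close> is used on two chains: from
      \<open>u\<close> to \<open>top\<close>, and from \<open>bot\<close> to \<open>top\<close> to
      express the upper part as a difference of ranks.\<close>
    have "tpow (\<rho> u top) = tpow (rank_of \<rho> top - rank_of \<rho> (sup b x)) * tpow (\<rho> u (sup b x))"
      if "u \<le> sup b x" for u
      using rank[of bot "sup b x" top] rank[of u "sup b x" top] that
      by (simp add: rank_of_def add.commute flip: tpow_add)
    then show ?thesis
      unfolding char_poly_interval_def sum_distrib_left T_def
      by (intro sum.cong) (auto simp: mult_ac)
  qed
  have "char_poly \<rho> = (\<Sum>u\<in>UNIV. \<Sum>b | inf b x = bot \<and> b \<le> u \<and> u \<le> sup b x. T b u)"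
    unfolding char_poly_def T_def
    by (subst mobius_left_modular[OF assms(2)]) (simp add: of_int_sum sum_distrib_right)
  also have "\<dots> = (\<Sum>b\<in>UNIV. \<Sum>u | inf b x = bot \<and> b \<le> u \<and> u \<le> sup b x. T b u)"
    using sum.swap_restrict[of UNIV UNIV "\<lambda>u b. T b u"
        "\<lambda>u b. inf b x = bot \<and> b \<le> u \<and> u \<le> sup b x"] by simp
  \<comment> \<open>Outside the support every \<open>T b u\<close> is 0; where
    \<open>inf b x\<close> is not \<open>bot\<close> the inner sum is empty.\<close>
  also have "\<dots> = (\<Sum>b\<in>{b \<in> mobius_support. inf b x = bot}. \<Sum>u\<in>{b..sup b x}. T b u)"
    by (rule sum.mono_neutral_cong_right)
      (auto simp: mobius_support_def T_def intro!: sum.neutral sum.cong)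
  finally show ?thesis by (simp only: summand)
qed

end
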